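(* For every $\varepsilon>0$, the quantity $N_\varepsilon=\sup N_\varepsilon(x,y)$ is finite, where $N_\varepsilon(x,y)$ is the number of zeroes of the adjoint variable $\psi$ along an optimal (minimum-time) trajectory of the controlled pendulum $\dot x=y,\ \dot y=-\sin x+\varepsilon u,\ |u|\le 1$, connecting $(x,y)$ with $(0,0)$, and the supremum is taken over the entire phase space.
   Context: Setting. The phase space is the cylinder $S^1\times\mathbb{R}$ with coordinates $(x,y)$, $x\in S^1=\mathbb{R}/2\pi\mathbb{Z}$, $y=\dot x\in\mathbb{R}$. For $\varepsilon>0$ the control system is $\dot x=y,\ \dot y=-\sin x+\varepsilon u$, with measurable controls $u=u(t)$, $|u|\le1$. An optimal trajectory is a trajectory $(x(t),y(t))$, $t\in[0,T]$, that goes from its initial point to the lower equilibrium $(0,0)$ in the minimal possible time (an optimal control exists for every initial point). Adjoint variables. By the Pontryagin maximum principle an optimal trajectory is accompanied by adjoint variables $(\phi,\psi)$ on $[0,T]$ satisfying $\dot\phi=(\cos x)\psi$, $\dot\psi=-\phi$, $u=\operatorname{sign}\psi$ (wherever $\psi\neq0$), and $y\phi+(-\sin x+\varepsilon u)\psi-1\equiv0$. In particular $\ddot\psi+(\cos x)\psi=0$, and the zeroes of $\psi$ are the possible switching instants of the control. Convention. $N_\varepsilon(x,y)$ is the number of zeroes of $\psi$ on $[0,T]$; $N_\varepsilon$ is the supremum of this number over all initial points $(x,y)$, all optimal trajectories from $(x,y)$ to $(0,0)$, and all adjoint variables $(\phi,\psi)$ on $[0,T]$ satisfying $\dot\phi=(\cos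 x)\psi$, $\dot\psi=-\phi$, $u=\operatorname{sign}\psi$ (wherever $\psi\neq0$) and $y\phi+(-\sin x+\varepsilon u)\psi-1\equiv0$ along the trajectory. *)

theory Defs
  imports "HOL-Analysis.Analysis" "HOL-Library.Real_Mod"
begin

(* A point of the cylinder S^1 x R, with S^1 = R/2 pi Z, is given by a representative in R x R;
   two representatives are the same point iff the following relation holds. *)
definition cyl_eq :: "real \<times> real \<Rightarrow> real \<times> real \<Rightarrow> bool" where
  "cyl_eq p q \<longleftrightarrow> [fst p = fst q] (rmod (2 * pi)) \<and> snd p = snd q"

definition admissible_control :: "real \<Rightarrow> (real \<Rightarrow> real) \<Rightarrow> bool" where
  "admissible_control T u \<longleftrightarrow>
     u \<in> borel_measurable (lebesgue_on {0..T}) \<and> (\<forall>t\<in>{0..T}. \<bar>u t\<bar> \<le> 1)"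

(* Here x is a continuous real-valued lift of the angle.  The second equation is required in
   integral (Caratheodory) form, since u is only measurable; y is then continuous on [0,T], so
   the first equation holds at every instant. *)
definition trajectory ::
  "real \<Rightarrow> real \<Rightarrow> (real \<Rightarrow> real) \<Rightarrow> (real \<Rightarrow> real) \<Rightarrow> (real \<Rightarrow> real) \<Rightarrow> bool" where
  "trajectory \<epsilon> T u x y \<longleftrightarrow>
     0 \<le> T \<and> admissible_control T u \<and>
     (\<forall>t\<in>{0..T}. (x has_real_derivative y t) (at t within {0..T})) \<and>
     (\<forall>t\<in>{0..T}. ((\<lambda>s. - sin (x s) + \<epsilon> * u s) has_integral (y t - y 0)) {0..t})"

definition steers_to_origin ::
  "real \<Rightarrow> real \<times> real \<Rightarrow> real \<Rightarrow> (real \<Rightarrow> real) \<Rightarrow> (real \<Rightarrow> real) \<Rightarrow> (real \<Rightarrow> real) \<Rightarrow> bool" where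
  "steers_to_origin \<epsilon> p T u x y \<longleftrightarrow>
     trajectory \<epsilon> T u x y \<and> cyl_eq (x 0, y 0) p \<and> cyl_eq (x T, y T) (0, 0)"

definition optimal_trajectory ::
  "real \<Rightarrow> real \<times> real \<Rightarrow> real \<Rightarrow> (real \<Rightarrow> real) \<Rightarrow> (real \<Rightarrow> real) \<Rightarrow> (real \<Rightarrow> real) \<Rightarrow> bool" where
  "optimal_trajectory \<epsilon> p T u x y \<longleftrightarrow>
     steers_to_origin \<epsilon> p T u x y \<and>
     (\<forall>T' u' x' y'. steers_to_origin \<epsilon> p T' u' x' y' \<longrightarrow> T \<le> T')"

(* The control is only determined up to a null set, so the two conditions involving u are
   required almost everywhere. *)
definition adjoint_variables ::
  "real \<Rightarrow> real \<Rightarrow> (real \<Rightarrow> real) \<Rightarrow> (real \<Rightarrow> real) \<Rightarrow> (real \<Rightarrow> real) \<Rightarrow>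
   (real \<Rightarrow> real) \<Rightarrow> (real \<Rightarrow> real) \<Rightarrow> bool" where
  "adjoint_variables \<epsilon> T u x y \<phi> \<psi> \<longleftrightarrow>
     (\<forall>t\<in>{0..T}. (\<phi> has_real_derivative cos (x t) * \<psi> t) (at t within {0..T})) \<and>
     (\<forall>t\<in>{0..T}. (\<psi> has_real_derivative - \<phi> t) (at t within {0..T})) \<and>
     (AE t in lebesgue_on {0..T}. \<psi> t \<noteq> 0 \<longrightarrow> u t = sgn (\<psi> t)) \<and>
     (AE t in lebesgue_on {0..T}. y t * \<phi> t + (- sin (x t) + \<epsilon> * u t) * \<psi> t - 1 = 0)"

definition zero_count :: "real \<Rightarrow> (real \<Rightarrow> real) \<Rightarrow> enat" where
  "zero_count T \<psi> =
     (let Z = {t \<in> {0..T}. \<psi> t = 0} in if finite Z then enat (card Z) else \<infinity>)"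

(* An optimal trajectory from p and its adjoint variables need not be unique; N_at takes the
   supremum over all of them. *)
definition N_at :: "real \<Rightarrow> real \<times> real \<Rightarrow> enat" where
  "N_at \<epsilon> p = Sup {zero_count T \<psi> | T u x y \<phi> \<psi>.
     optimal_trajectory \<epsilon> p T u x y \<and> adjoint_variables \<epsilon> T u x y \<phi> \<psi>}"

definition N_sup :: "real \<Rightarrow> enat" where
  "N_sup \<epsilon> = (SUP p. N_at \<epsilon> p)"

end

(*
  At a zero of psi the Hamiltonian identity reads y phi = 1. Since psi' = - phi alternates in sign
  at consecutive zeros of psi, so does y, hence the pendulum is at rest (y = 0) at some instant
  between the first two zeros. From there the remaining time is at most a constant M, and as zeros
  of psi are at least 1 apart, their number is at most M + 2.

  For the constant M: the free pendulum started at rest at an angle a follows a closed orbit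
  (constant at the upper equilibrium). Adding a small multiple of 1 and cos to this orbit moves its
  two end points independently at the cost of a small control, so any two rest points close to a
  are connected in a time depending only on a. A bisection over [-pi, pi] turns this into a uniform
  bound.
*)

theory Submission
  imports Defs
begin

section \<open>Building, cutting and joining controlled trajectories\<close>

text \<open>Measurability of \<open>u\<close> is recovered from the integral equation: the
  right-hand side is integrable, hence measurable, \<open>x\<close> is continuous, and
  \<open>\<epsilon> \<noteq> 0\<close> allows solving for \<open>u\<close>.\<close>

lemma trajectoryI:
  assumes "0 \<le> T" "\<epsilon> \<noteq> 0" "\<And>t. t \<in> {0..T} \<Longrightarrow> \<bar>u t\<bar> \<le> 1"
    and x: "\<And>t. t \<in> {0..T} \<Longrightarrow> (x has_real_derivative y t) (at t within {0..T})"
    and I: "\<And>t. t \<in> {0..T} \<Longrightarrow>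
      ((\<lambda>s. - sin (x s) + \<epsilon> * u s) has_integral (y t - y 0)) {0..t}"
  shows "trajectory \<epsilon> T u x y"
proof -
  have "continuous_on {0..T} x"
    using x by (rule DERIV_continuous_on)
  then have s: "(\<lambda>s. sin (x s)) \<in> borel_measurable (lebesgue_on {0..T})"
    by (intro continuous_imp_measurable_on_sets_lebesgue continuous_intros) auto
  have "(\<lambda>s. - sin (x s) + \<epsilon> * u s) integrable_on {0..T}"
    using I[of T] \<open>0 \<le> T\<close> by (auto simp: integrable_on_def)
  then have "(\<lambda>s. - sin (x s) + \<epsilon> * u s) \<in> borel_measurable (lebesgue_on {0..T})"
    by (rule integrable_imp_measurable)
  then have "(\<lambda>s. ((- sin (x s) + \<epsilon> * u s) + sin (x s)) / \<epsilon>) \<in> borel_measurable (lebesgue_on {0..T})"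
    using s by measurable
  then have "u \<in> borel_measurable (lebesgue_on {0..T})"
    using \<open>\<epsilon> \<noteq> 0\<close> by simp
  with assms show ?thesis
    by (auto simp: trajectory_def admissible_control_def)
qed

text \<open>Solving the second equation for the control turns \<open>\<bar>u\<bar> \<le> 1\<close>
  into a bound on the residual \<open>z + sin x\<close>. Trajectories can thus be constructed by
  prescribing the path alone.\<close>

lemma trajectory_of_C2_path:
  assumes "0 \<le> T" "\<epsilon> > 0"
    and x: "\<And>t. t \<in> {0..T} \<Longrightarrow> (x has_real_derivative y t) (at t within {0..T})"
    and y: "\<And>t. t \<in> {0..T} \<Longrightarrow> (y has_real_derivative z t) (at t within {0..T})"
    and z: "\<And>t. t \<in> {0..T} \<Longrightarrow> \<bar>z t + sin (x t)\<bar> \<le> \<epsilon>"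
  shows "trajectory \<epsilon> T (\<lambda>t. (z t + sin (x t)) / \<epsilon>) x y"
proof (rule trajectoryI)
  fix t assume t: "t \<in> {0..T}"
  have "(z has_integral (y t - y 0)) {0..t}"
    using t y by (intro fundamental_theorem_of_calculus)
      (auto simp flip: has_real_derivative_iff_has_vector_derivative intro: DERIV_subset[where s="{0..T}"])
  then show "((\<lambda>s. - sin (x s) + \<epsilon> * ((z s + sin (x s)) / \<epsilon>)) has_integral (y t - y 0)) {0..t}"
    using \<open>\<epsilon> > 0\<close> by simp
qed (use assms in \<open>auto simp: abs_divide\<close>)

lemma trajectory_take:
  assumes "trajectory \<epsilon> T u x y" "0 \<le> s" "s \<le> T" "\<epsilon> \<noteq> 0"
  shows "trajectory \<epsilon> s u x y"
  using assms by (intro trajectoryI)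
    (auto simp: trajectory_def admissible_control_def intro: DERIV_subset[where s="{0..T}"])

lemma trajectory_shift:
  assumes "trajectory \<epsilon> T u x y"
  shows "trajectory \<epsilon> T u (\<lambda>t. x t + of_int n * (2 * pi)) y"
proof -
  have [simp]: "sin (a + of_int n * (2 * pi)) = sin a" for a :: real
    by (metis rcong_altdef sin_rcong)
  have "((\<lambda>t. x t + of_int n * (2 * pi)) has_real_derivative y t) (at t within {0..T})"
    if "t \<in> {0..T}" for t
    using assms that by (auto simp: trajectory_def intro!: derivative_eq_intros)
  with assms show ?thesis
    by (simp add: trajectory_def)
qed

lemma trajectory_concat:
  assumes "\<epsilon> \<noteq> 0"
    and 1: "trajectory \<epsilon> T u x y" and 2: "trajectory \<epsilon> T' u' x' y'"
    and j: "x T = x' 0" "y T = y' 0"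
  shows "trajectory \<epsilon> (T + T') (\<lambda>t. if t \<in> {0..T} then u t else u' (t - T))
    (\<lambda>t. if t \<in> {0..T} then x t else x' (t - T)) (\<lambda>t. if t \<in> {0..T} then y t else y' (t - T))"
    (is "trajectory \<epsilon> _ ?u ?x ?y")
proof (rule trajectoryI)
  have T: "0 \<le> T" "0 \<le> T'"
    using 1 2 by (auto simp: trajectory_def)
  then show "0 \<le> T + T'"
    by simp
  show "\<bar>?u t\<bar> \<le> 1" if "t \<in> {0..T+T'}" for t
    using 1 2 that by (auto simp: trajectory_def admissible_control_def)
  show "(?x has_real_derivative ?y t) (at t within {0..T+T'})" if "t \<in> {0..T+T'}" for t
    unfolding has_real_derivative_iff_has_vector_derivative
  proof (rule has_vector_derivative_If_within_closures[where T="{T..T+T'}"])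
    show "t \<in> {0..T} \<union> {T..T+T'}" "{0..T+T'} = {0..T} \<union> {T..T+T'}"
      using that T by auto
    \<comment> \<open>The closures of the two time intervals meet only in the junction
      \<open>T\<close>, which belongs to both, so each piece has to be differentiated only within
      its own interval.\<close>
    have *: "{0..T} \<union> closure {0..T} \<inter> closure {T..T+T'} = {0..T}"
      "{T..T+T'} \<union> closure {0..T} \<inter> closure {T..T+T'} = {T..T+T'}"
      using T by auto
    show "(x has_vector_derivative y t) (at t within {0..T} \<union> closure {0..T} \<inter> closure {T..T+T'})"
      if "t \<in> {0..T} \<union> closure {0..T} \<inter> closure {T..T+T'}"
      using 1 that unfolding * trajectory_def
      by (simp add: has_real_derivative_iff_has_vector_derivative)
    show "((\<lambda>t. x' (t - T)) has_vector_derivative y' (t - T))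
        (at t within {T..T+T'} \<union> closure {0..T} \<inter> closure {T..T+T'})"
      if "t \<in> {T..T+T'} \<union> closure {0..T} \<inter> closure {T..T+T'}"
    proof -
      have "(x' has_real_derivative y' (t - T)) (at (t - T) within (\<lambda>t. t - T) ` {T..T+T'})"
        using 2 that unfolding * trajectory_def by auto
      then have "(x' \<circ> (\<lambda>t. t - T) has_real_derivative y' (t - T) * 1) (at t within {T..T+T'})"
        by (rule DERIV_image_chain) (auto intro!: derivative_eq_intros)
      then show ?thesis
        unfolding * by (simp add: has_real_derivative_iff_has_vector_derivative o_def)
    qed
  qed (use T j in auto)
  let ?f = "\<lambda>s. - sin (?x s) + \<epsilon> * ?u s"
  have first: "(?f has_integral (y t - y 0)) {0..t}" if "t \<in> {0..T}" for t
    using 1 that by (subst has_integral_cong[where g="\<lambda>s. - sin (x s) + \<epsilon> * u s"])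
      (auto simp: trajectory_def)
  show "(?f has_integral (?y t - ?y 0)) {0..t}" if t: "t \<in> {0..T+T'}" for t
  proof (cases "t \<le> T")
    case True
    then show ?thesis
      using first[of t] t T by simp
  next
    case False
    have "((\<lambda>s. - sin (x' s) + \<epsilon> * u' s) has_integral (y' (t - T) - y' 0)) {0..t-T}"
      using 2 t False by (auto simp: trajectory_def)
    then have "((\<lambda>s. - sin (x' s) + \<epsilon> * u' s) \<circ> (+) (-T) has_integral (y' (t - T) - y' 0)) {T..t}"
      by (subst has_integral_shift_Icc_real) simp
    \<comment> \<open>At the junction \<open>T\<close> itself the joined integrand takes its value
      from the first piece; this single point does not affect the integral.\<close>
    then have "(?f has_integral (y' (t - T) - y' 0)) {T..t}"
      by (rule has_integral_spike_finite[of "{T}", rotated 2]) auto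
    with first[of T] T False have "(?f has_integral ((y T - y 0) + (y' (t - T) - y' 0))) {0..t}"
      by (intro has_integral_combine[of 0 T t]) auto
    with False T j show ?thesis
      by simp
  qed
qed (use assms in auto)

section \<open>Closed orbits of the free pendulum\<close>

text \<open>Separation of variables: an antiderivative \<open>F\<close> of \<open>1 / h\<close>
  gives time as a function of position, and the solution \<open>g\<close> is its inverse, shifted to
  start at \<open>a\<close>.\<close>

lemma monotone_flow_exists:
  fixes h :: "real \<Rightarrow> real"
  assumes h: "continuous_on UNIV h" and pos: "\<And>s. h s > 0" and "a < b"
  obtains g P where "P > 0" "g 0 = a" "g P = b"
    "\<And>t. t \<in> {0..P} \<Longrightarrow> (g has_real_derivative h (g t)) (at t)"
proof -
  \<comment> \<open>The outer margin gives \<open>F\<close> two-sided derivatives on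
    \<open>{a-1..b+1}\<close>; the inner one makes \<open>a\<close> and \<open>b\<close> interior
    points of the interval on which \<open>F\<close> is inverted.\<close>
  have "continuous_on {a-2..b+2} (\<lambda>s. inverse (h s))"
    using h pos by (intro continuous_intros continuous_on_subset[OF h]) (auto simp: less_imp_neq[symmetric])
  then obtain F where F: "\<And>s. s \<in> {a-2..b+2} \<Longrightarrow> (F has_real_derivative inverse (h s)) (at s within {a-2..b+2})"
    unfolding has_real_derivative_iff_has_vector_derivative
    by (rule antiderivative_continuous) blast
  have DF: "(F has_real_derivative inverse (h s)) (at s)" if "s \<in> {a-1..b+1}" for s
    using F[of s] that at_within_interior[of s "{a-2..b+2}"] by simp
  have mono: "F s < F t" if "s < t" "s \<in> {a-1..b+1}" "t \<in> {a-1..b+1}" for s t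
  proof (rule DERIV_pos_imp_increasing[OF \<open>s < t\<close>])
    show "\<exists>D. (F has_real_derivative D) (at r) \<and> 0 < D" if "s \<le> r" "r \<le> t" for r
      using DF[of r] pos[of r] that \<open>s \<in> _\<close> \<open>t \<in> _\<close>
      by (intro exI[of _ "inverse (h r)"]) auto
  qed
  then have inj: "inj_on F {a-1..b+1}"
    by (intro linorder_inj_onI) (auto, metis less_irrefl)
  define g where "g t = inv_into {a-1..b+1} F (t + F a)" for t
  have gF: "g (F s - F a) = s" if "s \<in> {a-1..b+1}" for s
    using inj that by (simp add: g_def)
  have cF: "isCont F s" if "s \<in> {a-1..b+1}" for s
    using DF[OF that] by (rule DERIV_isCont)
  have onto: "\<exists>s\<in>{p..q}. t = F s - F a" if "t \<in> {F p - F a..F q - F a}" "p \<le> q" "p \<in> {a-1..b+1}" "q \<in> {a-1..b+1}" for t p q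
    using IVT'[of F p "t + F a" q] that cF continuous_at_imp_continuous_on[of "{p..q}" F]
    by (force simp: algebra_simps)
  show ?thesis
  proof (rule that[of "F b - F a" g])
    show "F b - F a > 0" "g 0 = a" "g (F b - F a) = b"
      using mono[of a b] gF[of a] gF[of b] \<open>a < b\<close> by auto
    fix t assume t: "t \<in> {0..F b - F a}"
    then obtain s where s: "s \<in> {a..b}" "t = F s - F a"
      using onto[of t a b] \<open>a < b\<close> by auto
    have "isCont g (F s - F a)"
      by (rule isCont_inverse_function2[where f="\<lambda>s. F s - F a" and a="a-1" and b="b+1"])
        (use s gF cF in \<open>auto intro!: continuous_intros\<close>)
    then have cg: "isCont g t"
      using s by simp
    have "(g has_real_derivative inverse (inverse (h (g t)))) (at t)"
    proof (rule DERIV_inverse_function[where f="\<lambda>s. F s - F a"])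
      have "g t = s"
        using gF[of s] s by simp
      then show "((\<lambda>s. F s - F a) has_real_derivative inverse (h (g t))) (at (g t))"
        using DF[of s] s by (auto intro!: derivative_eq_intros)
      show "F (a-1) - F a < t" "t < F (b+1) - F a"
        using mono[of "a-1" s] mono[of s "b+1"] s by auto
      show "F (g r) - F a = r" if r: "F (a-1) - F a < r" "r < F (b+1) - F a" for r
      proof -
        obtain q where "q \<in> {a-1..b+1}" "r = F q - F a"
          using onto[of r "a-1" "b+1"] r \<open>a < b\<close> by auto
        then show ?thesis
          using gF by simp
      qed
    qed (use cg pos[of "g t"] in auto)
    then show "(g has_real_derivative h (g t)) (at t)"
      by simp
  qed
qed

text \<open>The substitution \<open>sin (x / 2) = k * sin \<theta>\<close> turns the conservation of energy into
  \<open>\<theta>' = sqrt (1 - k\<^sup>2 * (sin \<theta>)\<^sup>2)\<close>, whose right-hand side is positive for \<open>\<bar>a\<bar> < pi\<close>; one period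
  of the orbit corresponds to \<open>\<theta>\<close> running from \<open>- pi / 2\<close> to \<open>3 / 2 * pi\<close>.\<close>

lemma pendulum_closed_orbit:
  assumes "\<bar>a\<bar> \<le> pi"
  obtains x y :: "real \<Rightarrow> real" and P where "P > 0" "x 0 = a" "y 0 = 0" "x P = a" "y P = 0"
    "\<And>t. t \<in> {0..P} \<Longrightarrow> (x has_real_derivative y t) (at t within {0..P})"
    "\<And>t. t \<in> {0..P} \<Longrightarrow> (y has_real_derivative - sin (x t)) (at t within {0..P})"
proof (cases "\<bar>a\<bar> = pi")
  case True
  then have "sin a = 0"
    by (auto simp: abs_if split: if_splits) (metis minus_minus sin_minus sin_pi neg_0_equal_iff_equal)
  then show ?thesis
    by (intro that[of 1 "\<lambda>_. a" "\<lambda>_. 0"]) (auto intro!: derivative_eq_intros)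
next
  case False
  \<comment> \<open>The angle \<theta> starts at -pi/2, where its sine is -1, so this sign gives
    \<open>k * sin \<theta> = sin (a / 2)\<close> at the start, and again at 3/2 * pi.\<close>
  define k where "k = - sin (a / 2)"
  have a: "- pi / 2 < a / 2" "a / 2 < pi / 2"
    using False assms by auto
  have "cos (a / 2) > 0"
    using a by (intro cos_gt_zero_pi) auto
  then have k: "k\<^sup>2 < 1"
    by (simp add: k_def sin_squared_eq)
  have kw: "(k * sin s)\<^sup>2 < 1" for s
  proof -
    have "(k * sin s)\<^sup>2 \<le> k\<^sup>2 * 1"
      unfolding power_mult_distrib by (intro mult_left_mono) (auto simp: abs_square_le_1)
    with k show ?thesis by simp
  qed
  define h where "h s = sqrt (1 - (k * sin s)\<^sup>2)" for s
  have h: "h s > 0" for s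
    using kw[of s] by (simp add: h_def)
  have hc: "continuous_on UNIV h"
    unfolding h_def by (intro continuous_intros)
  have "- pi / 2 < 3 / 2 * pi"
    using pi_gt_zero by linarith
  then obtain g P where P: "P > 0" and g: "g 0 = - pi / 2" "g P = 3 / 2 * pi"
    and Dg: "\<And>t. t \<in> {0..P} \<Longrightarrow> (g has_real_derivative h (g t)) (at t)"
    using monotone_flow_exists[OF hc h] by metis
  define x y where "x t = 2 * arcsin (k * sin (g t))" and "y t = 2 * k * cos (g t)" for t
  have abs: "- 1 < k * sin s" "k * sin s < 1" for s
    using kw[of s] by (auto simp: abs_square_less_1)
  have "arcsin (sin (a / 2)) = a / 2"
    using a by (intro arcsin_sin) auto
  then have end_pts: "x 0 = a" "x P = a" "y 0 = 0" "y P = 0"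
    using cos_3over2_pi sin_3over2_pi unfolding x_def y_def g by (simp_all add: k_def)
  show ?thesis
  proof (rule that[OF P end_pts(1,3,2,4)])
    fix t assume t: "t \<in> {0..P}"
    \<comment> \<open>The derivative of \<open>arcsin\<close> contributes
      \<open>1 / h (g t)\<close>, which cancels against \<open>g' = h (g t)\<close>.\<close>
    have "(x has_real_derivative 2 * (inverse (h (g t)) * (k * (cos (g t) * h (g t))))) (at t)"
      unfolding x_def using abs[of "g t"] Dg[OF t]
      by (auto intro!: derivative_eq_intros simp: h_def)
    also have "2 * (inverse (h (g t)) * (k * (cos (g t) * h (g t)))) = y t"
      using h[of "g t"] by (simp add: y_def)
    finally show "(x has_real_derivative y t) (at t within {0..P})"
      by (rule has_field_derivative_at_within)
    have "(y has_real_derivative - (2 * (k * sin (g t)) * h (g t))) (at t)"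
      unfolding y_def using Dg[OF t] by (auto intro!: derivative_eq_intros)
    also have "2 * (k * sin (g t)) * h (g t) = sin (x t)"
      unfolding x_def sin_double h_def using abs[of "g t"] by (simp add: cos_arcsin sin_arcsin)
    finally show "(y has_real_derivative - sin (x t)) (at t within {0..P})"
      by (rule has_field_derivative_at_within)
  qed
qed

section \<open>Transfers between rest points in bounded time\<close>

text \<open>End angles are compared as real lifts, not modulo 2 pi, so that consecutive transfers
  can be joined; with the exact duration recorded, durations add.\<close>

definition rest_transfer :: "real \<Rightarrow> real \<Rightarrow> real \<Rightarrow> real \<Rightarrow> bool" where
  "rest_transfer \<epsilon> T b c \<longleftrightarrow>
     (\<exists>u x y. trajectory \<epsilon> T u x y \<and> x 0 = b \<and> y 0 = 0 \<and> x T = c \<and> y T = 0)"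

lemma rest_transferI:
  assumes "trajectory \<epsilon> T u x y" "x 0 = b" "y 0 = 0" "x T = c" "y T = 0"
  shows "rest_transfer \<epsilon> T b c"
  using assms by (auto simp: rest_transfer_def)

lemma rest_transfer_trans:
  assumes "\<epsilon> > 0" "rest_transfer \<epsilon> T a b" "rest_transfer \<epsilon> T' b c"
  shows "rest_transfer \<epsilon> (T + T') a c"
proof -
  from assms(2) obtain u x y where
    1: "trajectory \<epsilon> T u x y" "x 0 = a" "y 0 = 0" "x T = b" "y T = 0"
    by (auto simp: rest_transfer_def)
  from assms(3) obtain u' x' y' where
    2: "trajectory \<epsilon> T' u' x' y'" "x' 0 = b" "y' 0 = 0" "x' T' = c" "y' T' = 0"
    by (auto simp: rest_transfer_def)
  have "0 \<le> T" "0 \<le> T'"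
    using 1 2 by (auto simp: trajectory_def)
  then show ?thesis
    using 1 2 \<open>\<epsilon> > 0\<close> by (intro rest_transferI[OF trajectory_concat[OF _ 1(1) 2(1)]]) auto
qed

lemma abs_sin_diff_le: "\<bar>sin a - sin b\<bar> \<le> \<bar>a - b\<bar>" for a b :: real
  using field_differentiable_bound[of UNIV sin cos 1 a b] by simp

lemma rest_transfer_local:
  assumes "\<epsilon> > 0" "\<bar>a\<bar> \<le> pi"
  obtains \<delta> P where "\<delta> > 0" "\<And>b c. \<bar>b - a\<bar> < \<delta> \<Longrightarrow> \<bar>c - a\<bar> < \<delta> \<Longrightarrow> rest_transfer \<epsilon> P b c"
proof -
  from pendulum_closed_orbit[OF assms(2)] obtain x y P where P: "P > 0"
    and ends: "x 0 = a" "y 0 = 0" "x P = a" "y P = 0"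
    and x: "\<And>t. t \<in> {0..P} \<Longrightarrow> (x has_real_derivative y t) (at t within {0..P})"
    and y: "\<And>t. t \<in> {0..P} \<Longrightarrow> (y has_real_derivative - sin (x t)) (at t within {0..P})"
    by metis
  \<comment> \<open>Over \<open>[0, P]\<close> the term \<open>cos (w * t)\<close> runs through half
    a period, from 1 to -1, and its derivative vanishes at both ends, so the perturbed path also
    starts and ends at rest.\<close>
  define w where "w = pi / P"
  have wP: "P * w = pi"
    using P by (simp add: w_def)
  \<comment> \<open>The perturbation \<open>m + r * cos (w * t)\<close> costs at most
    \<open>\<bar>m\<bar> + \<bar>r\<bar>\<close> through the sine and
    \<open>\<bar>r\<bar> * w\<^sup>2\<close> through the second derivative, together at most
    \<open>\<delta> * (1 + w\<^sup>2)\<close>.\<close>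
  define \<delta> where "\<delta> = \<epsilon> / (1 + w\<^sup>2)"
  have pos: "1 + w\<^sup>2 > 0"
    by (simp add: add_pos_nonneg)
  have \<delta>: "\<delta> > 0" "\<delta> * (1 + w\<^sup>2) = \<epsilon>"
    using assms pos by (auto simp: \<delta>_def)
  show ?thesis
  proof (rule that[OF \<delta>(1), of P])
    fix b c assume bc: "\<bar>b - a\<bar> < \<delta>" "\<bar>c - a\<bar> < \<delta>"
    \<comment> \<open>The solution of \<open>m + r = b - a\<close> and \<open>m - r = c - a\<close>,
      the displacements wanted at the two ends. Hence \<open>\<bar>m\<bar> + \<bar>r\<bar>\<close>
      is the larger of \<open>\<bar>b - a\<bar>\<close> and
      \<open>\<bar>c - a\<bar>\<close>.\<close>
    define m r where "m = (b + c) / 2 - a" and "r = (b - c) / 2"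
    have mr: "\<bar>m\<bar> + \<bar>r\<bar> \<le> \<delta>"
      using bc by (auto simp: m_def r_def abs_if field_simps)
    let ?x = "\<lambda>t. x t + m + r * cos (w * t)" and ?y = "\<lambda>t. y t - r * w * sin (w * t)"
    let ?z = "\<lambda>t. - sin (x t) - r * w\<^sup>2 * cos (w * t)"
    have "trajectory \<epsilon> P (\<lambda>t. (?z t + sin (?x t)) / \<epsilon>) ?x ?y"
    proof (rule trajectory_of_C2_path)
      fix t assume t: "t \<in> {0..P}"
      show "(?x has_real_derivative ?y t) (at t within {0..P})"
        by (auto intro!: derivative_eq_intros x[OF t])
      show "(?y has_real_derivative ?z t) (at t within {0..P})"
        by (auto intro!: derivative_eq_intros y[OF t] simp: power2_eq_square)
      have rc: "\<bar>r * cos (w * t)\<bar> \<le> \<bar>r\<bar>"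
        unfolding abs_mult by (rule mult_left_le) auto
      have "\<bar>sin (?x t) - sin (x t)\<bar> \<le> \<bar>?x t - x t\<bar>"
        by (rule abs_sin_diff_le)
      also have "\<dots> \<le> \<delta>"
        using rc mr by linarith
      finally have 1: "\<bar>sin (?x t) - sin (x t)\<bar> \<le> \<delta>" .
      have "\<bar>r * w\<^sup>2 * cos (w * t)\<bar> = \<bar>r * cos (w * t)\<bar> * w\<^sup>2"
        by (simp add: abs_mult)
      also have "\<dots> \<le> \<delta> * w\<^sup>2"
        using rc mr by (intro mult_right_mono) auto
      finally show "\<bar>?z t + sin (?x t)\<bar> \<le> \<epsilon>"
        using 1 \<delta>(2) by (simp add: algebra_simps)
    qed (use P assms in auto)
    then show "rest_transfer \<epsilon> P b c"
      by (rule rest_transferI) (simp_all add: ends wP m_def r_def field_simps)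
  qed
qed

lemma rest_transfer_bounded:
  assumes "\<epsilon> > 0"
  obtains M where "\<And>b c. b \<in> {-pi..pi} \<Longrightarrow> c \<in> {-pi..pi} \<Longrightarrow> \<exists>T\<le>M. rest_transfer \<epsilon> T b c"
proof -
  \<comment> \<open>The bound is quantified inside \<open>Q\<close>: its mere existence passes from
    two adjacent intervals to their union, while its value grows.\<close>
  define Q where "Q l r \<longleftrightarrow> (\<exists>M. \<forall>b\<in>{l..r}\<inter>{-pi..pi}. \<forall>c\<in>{l..r}\<inter>{-pi..pi}. \<exists>T\<le>M. rest_transfer \<epsilon> T b c)"
    for l r
  have "- pi \<le> pi"
    by simp
  then have "Q (-pi) pi"
  proof (induction rule: Bolzano)
    case (trans l m r)
    then obtain M M' where
      M: "\<And>b c. b \<in> {l..m}\<inter>{-pi..pi} \<Longrightarrow> c \<in> {l..m}\<inter>{-pi..pi} \<Longrightarrow> \<exists>T\<le>M. rest_transfer \<epsilon> T b c" and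
      M': "\<And>b c. b \<in> {m..r}\<inter>{-pi..pi} \<Longrightarrow> c \<in> {m..r}\<inter>{-pi..pi} \<Longrightarrow> \<exists>T\<le>M'. rest_transfer \<epsilon> T b c"
      unfolding Q_def by blast
    \<comment> \<open>The absolute values dominate \<open>M\<close>, \<open>M'\<close> and
      \<open>M + M'\<close> alike, even if an interval misses \<open>[-pi, pi]\<close> and its
      constant is negative.\<close>
    have "\<exists>T\<le>\<bar>M\<bar> + \<bar>M'\<bar>. rest_transfer \<epsilon> T b c"
      if bc: "b \<in> {l..r}\<inter>{-pi..pi}" "c \<in> {l..r}\<inter>{-pi..pi}" for b c
    proof -
      consider "b \<le> m" "c \<le> m" | "m \<le> b" "m \<le> c" | "b \<le> m" "m \<le> c" | "m \<le> b" "c \<le> m"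
        by linarith
      then show ?thesis
      proof cases
        case 1
        then obtain T where "T \<le> M" "rest_transfer \<epsilon> T b c"
          using M[of b c] bc by auto
        then show ?thesis
          by (intro exI[of _ T]) auto
      next
        case 2
        then obtain T where "T \<le> M'" "rest_transfer \<epsilon> T b c"
          using M'[of b c] bc by auto
        then show ?thesis
          by (intro exI[of _ T]) auto
      next
        \<comment> \<open>The common end point \<open>m\<close> serves as an intermediate stop;
          lying between \<open>b\<close> and \<open>c\<close>, it is in
          \<open>[-pi, pi]\<close>.\<close>
        case 3
        then obtain T T' where "T \<le> M" "T' \<le> M'" "rest_transfer \<epsilon> T b m" "rest_transfer \<epsilon> T' m c"
          using M[of b m] M'[of m c] bc by auto
        then show ?thesis
          using rest_transfer_trans[OF assms, of T b m T' c] by (intro exI[of _ "T + T'"]) auto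
      next
        case 4
        then obtain T T' where "T \<le> M'" "T' \<le> M" "rest_transfer \<epsilon> T b m" "rest_transfer \<epsilon> T' m c"
          using M'[of b m] M[of m c] bc by auto
        then show ?thesis
          using rest_transfer_trans[OF assms, of T b m T' c] by (intro exI[of _ "T + T'"]) auto
      qed
    qed
    then show ?case
      unfolding Q_def by blast
  next
    case (local a)
    then obtain \<delta> P where \<delta>: "\<delta> > 0"
      "\<And>b c. \<bar>b - a\<bar> < \<delta> \<Longrightarrow> \<bar>c - a\<bar> < \<delta> \<Longrightarrow> rest_transfer \<epsilon> P b c"
      using rest_transfer_local[OF assms, of a] by (auto simp: abs_le_iff)
    have "Q l r" if "l \<le> a" "a \<le> r" "r - l < \<delta>" for l r
      unfolding Q_def using that by (intro exI[of _ P] ballI exI[of _ P] conjI \<delta>(2)) auto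
    with \<delta>(1) show ?case
      by blast
  qed
  then obtain M where "\<forall>b\<in>{-pi..pi}. \<forall>c\<in>{-pi..pi}. \<exists>T\<le>M. rest_transfer \<epsilon> T b c"
    unfolding Q_def by auto
  then show ?thesis
    by (intro that[of M]) blast
qed

text \<open>One bound serves all real angles because the target is only prescribed modulo 2 pi:
  whole turns are removed from the initial angle and added back to the path.\<close>

lemma steer_to_origin_bounded:
  assumes "\<epsilon> > 0"
  obtains M where "\<And>a. \<exists>T u x y. T \<le> M \<and> trajectory \<epsilon> T u x y \<and> x 0 = a \<and> y 0 = 0 \<and> cyl_eq (x T, y T) (0, 0)"
proof -
  obtain M where M: "\<And>b c. b \<in> {-pi..pi} \<Longrightarrow> c \<in> {-pi..pi} \<Longrightarrow> \<exists>T\<le>M. rest_transfer \<epsilon> T b c"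
    using rest_transfer_bounded[OF assms] by blast
  have "\<exists>T u x y. T \<le> M \<and> trajectory \<epsilon> T u x y \<and> x 0 = a \<and> y 0 = 0 \<and> cyl_eq (x T, y T) (0, 0)" for a
  proof -
    \<comment> \<open>The number of whole turns for which \<open>a - n * (2 * pi)\<close> lies in
      \<open>[-pi, pi)\<close>.\<close>
    define n where "n = \<lfloor>(a + pi) / (2 * pi)\<rfloor>"
    have n: "of_int n * (2 * pi) \<le> a + pi" "a + pi < (of_int n + 1) * (2 * pi)"
      using floor_divide_lower[of "2 * pi" "a + pi"] floor_divide_upper[of "2 * pi" "a + pi"]
      by (simp_all add: n_def)
    then have "\<exists>T\<le>M. rest_transfer \<epsilon> T (a - of_int n * (2 * pi)) 0"
      by (intro M) (auto simp: algebra_simps)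
    then obtain T u x y where T: "T \<le> M" "trajectory \<epsilon> T u x y" "x 0 = a - of_int n * (2 * pi)"
      "y 0 = 0" "x T = 0" "y T = 0"
      unfolding rest_transfer_def by auto
    have "[of_int n * (2 * pi) = 0] (rmod (2 * pi))"
      unfolding rcong_altdef by (rule exI[of _ "-n"]) simp
    then show ?thesis
      using T trajectory_shift[OF T(2), of n]
      by (intro exI[of _ T] exI[of _ u] exI[of _ "\<lambda>t. x t + of_int n * (2 * pi)"] exI[of _ y])
        (simp add: cyl_eq_def)
  qed
  with that show ?thesis
    by blast
qed

section \<open>Zeros of the adjoint variable \<open>\<psi>\<close>\<close>

lemma trajectory_continuous:
  assumes "trajectory \<epsilon> T u x y"
  shows "continuous_on {0..T} x" "continuous_on {0..T} y"
proof -
  show "continuous_on {0..T} x"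
    using assms by (intro DERIV_continuous_on[where D=y]) (simp add: trajectory_def)
  let ?f = "\<lambda>s. - sin (x s) + \<epsilon> * u s"
  have f: "(?f has_integral (y t - y 0)) {0..t}" if "t \<in> {0..T}" for t
    using assms that by (auto simp: trajectory_def)
  have "0 \<le> T"
    using assms by (simp add: trajectory_def)
  then have "continuous_on {0..T} (\<lambda>t. y 0 + integral {0..t} ?f)"
    using f[of T] by (intro continuous_intros indefinite_integral_continuous_1)
      (auto simp: integrable_on_def)
  then show "continuous_on {0..T} y"
    by (rule continuous_on_cong[THEN iffD1, rotated 2]) (use integral_unique[OF f] in auto)
qed

text \<open>A closed set containing almost every point of an open interval contains the whole
  interval, and then its end points. This turns almost-everywhere conditions into pointwise
  ones.\<close>

lemma AE_nonpos_imp_nonpos: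
  fixes F :: "real \<Rightarrow> real"
  assumes "0 < T" "continuous_on {0..T} F" "AE t in lebesgue_on {0..T}. F t \<le> 0" "s \<in> {0..T}"
  shows "F s \<le> 0"
proof -
  \<comment> \<open>Clamping the argument to \<open>[0, T]\<close> extends \<open>F\<close>
    continuously to the whole line, so that \<open>C\<close> is closed there.\<close>
  define C where "C = {t. F (max 0 (min T t)) \<le> 0}"
  have "continuous_on UNIV (\<lambda>t. F (max 0 (min T t)))"
    using \<open>0 < T\<close> by (intro continuous_on_compose2[OF assms(2)] continuous_intros) auto
  then have "closed C"
    unfolding C_def by (intro closed_Collect_le continuous_intros)
  have "AE t in lebesgue. t \<in> {0..T} \<longrightarrow> F t \<le> 0"
    using assms(3) by (subst (asm) AE_restrict_space_iff) auto
  then have "AE t \<in> {0<..<T} in lebesgue. t \<in> C"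
    by (rule AE_mp) (auto simp: C_def)
  then have "{0<..<T} \<subseteq> C"
    using mem_closed_if_AE_lebesgue_open[OF open_greaterThanLessThan \<open>closed C\<close>] by blast
  then have "closure {0<..<T} \<subseteq> C"
    using \<open>closed C\<close> by (rule closure_minimal)
  then have "s \<in> C"
    using assms(1,4) by auto
  with assms(4) show ?thesis
    by (simp add: C_def)
qed

lemma adjoint_derivatives:
  assumes "adjoint_variables \<epsilon> T u x y \<phi> \<psi>" "0 \<le> s" "t \<le> T" "r \<in> {s..t}"
  shows "(\<phi> has_real_derivative cos (x r) * \<psi> r) (at r within {s..t})"
    "(\<psi> has_real_derivative - \<phi> r) (at r within {s..t})"
proof -
  have "r \<in> {0..T}" and sub: "{s..t} \<subseteq> {0..T}"
    using assms(2-4) by auto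
  with assms(1) have "(\<phi> has_real_derivative cos (x r) * \<psi> r) (at r within {0..T})"
    "(\<psi> has_real_derivative - \<phi> r) (at r within {0..T})"
    unfolding adjoint_variables_def by blast+
  then show "(\<phi> has_real_derivative cos (x r) * \<psi> r) (at r within {s..t})"
    "(\<psi> has_real_derivative - \<phi> r) (at r within {s..t})"
    using sub by (blast intro: DERIV_subset)+
qed

text \<open>The Hamiltonian identity holds only almost everywhere and involves \<open>u\<close>, so
  it cannot be evaluated at \<open>s\<close> directly. Bounding \<open>u\<close> by 1 leaves
  \<open>\<bar>y * \<phi> - sin x * \<psi> - 1\<bar> \<le> \<epsilon> * \<bar>\<psi>\<bar>\<close>
  between continuous functions, which therefore holds at every instant.\<close>

lemma adjoint_at_zero:
  assumes "\<epsilon> > 0" "0 < T" "trajectory \<epsilon> T u x y" "adjoint_variables \<epsilon> T u x y \<phi> \<psi>"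
    "s \<in> {0..T}" "\<psi> s = 0"
  shows "y s * \<phi> s = 1"
proof -
  have "continuous_on {0..T} \<phi>"
    using adjoint_derivatives(1)[OF assms(4), of 0 T]
    by (intro DERIV_continuous_on) simp_all
  moreover have "continuous_on {0..T} \<psi>"
    using adjoint_derivatives(2)[OF assms(4), of 0 T]
    by (intro DERIV_continuous_on) simp_all
  ultimately have cont: "continuous_on {0..T} x" "continuous_on {0..T} y"
    "continuous_on {0..T} \<phi>" "continuous_on {0..T} \<psi>"
    using trajectory_continuous[OF assms(3)] by auto
  let ?F = "\<lambda>t. \<bar>y t * \<phi> t - sin (x t) * \<psi> t - 1\<bar> - \<epsilon> * \<bar>\<psi> t\<bar>"
  have "AE t in lebesgue_on {0..T}. y t * \<phi> t + (- sin (x t) + \<epsilon> * u t) * \<psi> t - 1 = 0"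
    using assms(4) by (simp add: adjoint_variables_def)
  then have "AE t in lebesgue_on {0..T}. ?F t \<le> 0"
  proof (rule lebesgue_on_mono)
    fix t assume "y t * \<phi> t + (- sin (x t) + \<epsilon> * u t) * \<psi> t - 1 = 0" and t: "t \<in> {0..T}"
    then have "y t * \<phi> t - sin (x t) * \<psi> t - 1 = - (\<epsilon> * (u t * \<psi> t))"
      by (simp add: algebra_simps)
    moreover have "\<bar>u t * \<psi> t\<bar> \<le> \<bar>\<psi> t\<bar>"
      using assms(3) t unfolding abs_mult trajectory_def admissible_control_def
      by (intro mult_left_le_one_le) auto
    ultimately show "?F t \<le> 0"
      using \<open>\<epsilon> > 0\<close> by (simp add: abs_mult)
  qed
  then have "?F s \<le> 0"
    by (intro AE_nonpos_imp_nonpos[of T ?F] assms continuous_intros cont)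
  with \<open>\<psi> s = 0\<close> show ?thesis
    by simp
qed

text \<open>By Rolle, \<open>\<phi>\<close> vanishes somewhere between two zeros of \<open>\<psi>\<close> at distance less than 1;
  integrating twice, the maximum of \<open>\<bar>\<phi>\<bar>\<close> would be less than itself.\<close>

lemma zeros_separated:
  fixes s t :: real
  assumes \<phi>: "\<And>r. r \<in> {s..t} \<Longrightarrow> (\<phi> has_real_derivative cos (x r) * \<psi> r) (at r within {s..t})"
    and \<psi>: "\<And>r. r \<in> {s..t} \<Longrightarrow> (\<psi> has_real_derivative - \<phi> r) (at r within {s..t})"
    and "s < t" "\<psi> s = 0" "\<psi> t = 0" "\<phi> s \<noteq> 0"
  shows "1 \<le> t - s"
proof (rule ccontr)
  assume "\<not> ?thesis"
  then have l: "t - s < 1" by simp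
  have c\<phi>: "continuous_on {s..t} \<phi>"
    using \<phi> by (rule DERIV_continuous_on)
  have c\<psi>: "continuous_on {s..t} \<psi>"
    using \<psi> by (rule DERIV_continuous_on)
  obtain c where c: "c \<in> {s..t}" "\<And>r. r \<in> {s..t} \<Longrightarrow> \<bar>\<phi> r\<bar> \<le> \<bar>\<phi> c\<bar>"
    using continuous_attains_sup[of "{s..t}" "\<lambda>r. \<bar>\<phi> r\<bar>", OF _ _ continuous_on_rabs[OF c\<phi>]] \<open>s < t\<close>
    by auto
  have M: "\<bar>\<phi> c\<bar> > 0"
    using c(2)[of s] assms by auto
  have D: "(\<psi> has_real_derivative - \<phi> r) (at r)" if "s < r" "r < t" for r
    using \<psi>[of r] at_within_interior[of r "{s..t}"] that by simp
  obtain r where r: "s < r" "r < t" "(\<psi> has_real_derivative 0) (at r)"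
    using Rolle[OF \<open>s < t\<close>, of \<psi>] c\<psi> D assms(4,5) by (auto simp: real_differentiable_def)
  have r0: "\<phi> r = 0"
    using DERIV_unique[OF D[OF r(1,2)] r(3)] by simp
  have b: "\<bar>\<psi> q\<bar> \<le> \<bar>\<phi> c\<bar> * (t - s)" if "q \<in> {s..t}" for q
  proof -
    have "norm (\<psi> q - \<psi> s) \<le> \<bar>\<phi> c\<bar> * norm (q - s)"
      by (rule field_differentiable_bound[of "{s..t}" \<psi> "\<lambda>r. - \<phi> r"]) (use that \<psi> c in auto)
    also have "\<dots> \<le> \<bar>\<phi> c\<bar> * (t - s)"
      using that by (intro mult_left_mono) auto
    finally show ?thesis
      using \<open>\<psi> s = 0\<close> by simp
  qed
  have "norm (\<phi> c - \<phi> r) \<le> \<bar>\<phi> c\<bar> * (t - s) * norm (c - r)"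
  proof (rule field_differentiable_bound[of "{s..t}" \<phi> "\<lambda>r. cos (x r) * \<psi> r"])
    show "norm (cos (x q) * \<psi> q) \<le> \<bar>\<phi> c\<bar> * (t - s)" if "q \<in> {s..t}" for q
      using b[OF that] mult_left_le_one_le[of "\<bar>\<psi> q\<bar>" "\<bar>cos (x q)\<bar>"] by (simp add: abs_mult)
  qed (use \<phi> c r in auto)
  also have "\<dots> \<le> \<bar>\<phi> c\<bar> * (t - s) * 1"
    using c(1) r l \<open>s < t\<close> by (intro mult_left_mono) auto
  also have "\<dots> < \<bar>\<phi> c\<bar>"
    using M l by simp
  finally show False
    using r0 by simp
qed

text \<open>The function is positive just after \<open>a\<close> and negative just before
  \<open>b\<close>, so the intermediate value theorem applies strictly inside.\<close>

lemma zero_between_upcrossings: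
  fixes f :: "real \<Rightarrow> real"
  assumes "a < b" "continuous_on {a..b} f" "f a = 0" "f b = 0"
    "(f has_real_derivative p) (at a within {a..b})" "p > 0"
    "(f has_real_derivative q) (at b within {a..b})" "q > 0"
  obtains c where "a < c" "c < b" "f c = 0"
proof -
  obtain d where d: "d > 0" "\<And>h. h > 0 \<Longrightarrow> a + h \<in> {a..b} \<Longrightarrow> h < d \<Longrightarrow> f a < f (a + h)"
    using has_real_derivative_pos_inc_right[OF assms(5,6)] by blast
  obtain e where e: "e > 0" "\<And>h. h > 0 \<Longrightarrow> b - h \<in> {a..b} \<Longrightarrow> h < e \<Longrightarrow> f (b - h) < f b"
    using has_real_derivative_pos_inc_left[OF assms(7,8)] by blast
  \<comment> \<open>The factor 1/3 keeps \<open>a + h\<close> to the left of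
    \<open>b - h\<close>.\<close>
  define h where "h = Min {d, e, b - a} / 3"
  have h: "h > 0" "h < d" "h < e" "3 * h \<le> b - a"
    using d(1) e(1) \<open>a < b\<close> by (auto simp: h_def)
  have "0 < f (a + h)" "f (b - h) < 0"
    using d(2)[of h] e(2)[of h] h assms(3,4) by auto
  moreover have "continuous_on {a+h..b-h} f"
    using h by (intro continuous_on_subset[OF assms(2)]) auto
  ultimately obtain c where "a + h \<le> c" "c \<le> b - h" "f c = 0"
    using IVT2'[of f "b - h" 0 "a + h"] h by auto
  then show ?thesis
    using that[of c] h by auto
qed

text \<open>If \<open>\<phi>\<close> had the same sign at both zeros, \<open>\<psi>\<close> would
  cross 0 twice in the same direction and vanish in between. So the signs differ, and by
  \<open>y * \<phi> = 1\<close> those of \<open>y\<close> differ too.\<close>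

lemma velocity_zero_between:
  assumes "\<epsilon> > 0" "trajectory \<epsilon> T u x y" "adjoint_variables \<epsilon> T u x y \<phi> \<psi>"
    and st: "0 \<le> s" "s < t" "t \<le> T" "\<psi> s = 0" "\<psi> t = 0" "\<And>r. s < r \<Longrightarrow> r < t \<Longrightarrow> \<psi> r \<noteq> 0"
  obtains r where "s \<le> r" "r \<le> t" "y r = 0"
proof -
  have \<psi>: "(\<psi> has_real_derivative - \<phi> r) (at r within {s..t})" if "r \<in> {s..t}" for r
    using adjoint_derivatives(2)[OF assms(3) st(1,3) that] .
  then have c: "continuous_on {s..t} \<psi>"
    by (rule DERIV_continuous_on)
  have yc: "continuous_on {s..t} y"
    using st by (intro continuous_on_subset[OF trajectory_continuous(2)[OF assms(2)]]) auto
  have y1: "y s * \<phi> s = 1" "y t * \<phi> t = 1"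
    using adjoint_at_zero[OF assms(1) _ assms(2,3)] st(1-5) by auto
  have "\<not> (\<phi> s < 0 \<and> \<phi> t < 0)"
  proof
    assume *: "\<phi> s < 0 \<and> \<phi> t < 0"
    obtain r where "s < r" "r < t" "\<psi> r = 0"
      by (rule zero_between_upcrossings[OF st(2) c st(4,5) \<psi> _ \<psi>]) (use * st(2) in auto)
    with st show False by blast
  qed
  \<comment> \<open>Here \<open>\<psi>\<close> crosses downwards at both ends, so the argument is
    applied to \<open>- \<psi>\<close>.\<close>
  moreover have "\<not> (\<phi> s > 0 \<and> \<phi> t > 0)"
  proof
    assume *: "\<phi> s > 0 \<and> \<phi> t > 0"
    have \<psi>': "((\<lambda>r. - \<psi> r) has_real_derivative \<phi> r) (at r within {s..t})" if "r \<in> {s..t}" for r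
      using DERIV_minus[OF \<psi>[OF that]] by simp
    obtain r where "s < r" "r < t" "\<psi> r = 0"
      by (rule zero_between_upcrossings[OF st(2) continuous_on_minus[OF c] _ _ \<psi>' _ \<psi>'])
        (use * st(2,4,5) in auto)
    with st show False by blast
  qed
  ultimately have "y s \<le> 0 \<and> 0 \<le> y t \<or> y t \<le> 0 \<and> 0 \<le> y s"
    using y1 zero_less_mult_iff[of "y s" "\<phi> s"] zero_less_mult_iff[of "y t" "\<phi> t"] by auto
  then obtain r where "s \<le> r" "r \<le> t" "y r = 0"
    using IVT'[of y s 0 t, OF _ _ _ yc] IVT2'[of y t 0 s, OF _ _ _ yc] st(2) by auto
  then show ?thesis
    by (rule that)
qed

section \<open>Counting the zeros\<close>

text \<open>Points at least 1 apart have distinct integer parts of their distance to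
  \<open>a\<close>; these lie among the integers from 0 to
  \<open>\<lfloor>b - a\<rfloor>\<close>.\<close>

lemma card_separated_le:
  fixes A :: "real set"
  assumes "A \<subseteq> {a..b}" and sep: "\<And>s t. s \<in> A \<Longrightarrow> t \<in> A \<Longrightarrow> s < t \<Longrightarrow> 1 \<le> t - s"
  shows "finite A" "card A \<le> nat \<lfloor>b - a\<rfloor> + 1"
proof -
  have inj: "inj_on (\<lambda>t. \<lfloor>t - a\<rfloor>) A"
  proof (rule linorder_inj_onI)
    fix s t assume "s < t" "s \<in> A" "t \<in> A"
    then have "s - a + 1 \<le> t - a"
      using sep[of s t] by simp
    then show "\<lfloor>s - a\<rfloor> \<noteq> \<lfloor>t - a\<rfloor>"
      by linarith
  qed auto
  have sub: "(\<lambda>t. \<lfloor>t - a\<rfloor>) ` A \<subseteq> {0..\<lfloor>b - a\<rfloor>}"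
    using assms(1) by (force intro: floor_mono)
  then show "finite A"
    using inj finite_imageD finite_subset by blast
  have "card A \<le> card {0..\<lfloor>b - a\<rfloor>}"
    using inj sub by (intro card_inj_on_le) auto
  then show "card A \<le> nat \<lfloor>b - a\<rfloor> + 1"
    by simp
qed

text \<open>Following the optimal trajectory up to \<open>s\<close> and the other one afterwards
  gives a competitor of duration \<open>s + T'\<close>.\<close>

lemma optimal_time_from_rest:
  assumes "\<epsilon> > 0" "optimal_trajectory \<epsilon> p T u x y" "s \<in> {0..T}"
    and c: "trajectory \<epsilon> T' u' x' y'" "x' 0 = x s" "y' 0 = y s" "cyl_eq (x' T', y' T') (0, 0)"
  shows "T \<le> s + T'"
proof -
  have tr: "trajectory \<epsilon> T u x y" and cyl: "cyl_eq (x 0, y 0) p"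
    using assms(2) unfolding optimal_trajectory_def steers_to_origin_def by blast+
  have T': "0 \<le> T'"
    using c by (simp add: trajectory_def)
  have "trajectory \<epsilon> s u x y"
    using trajectory_take[OF tr] assms(1,3) by auto
  note concat = trajectory_concat[OF _ this c(1)]
  have "steers_to_origin \<epsilon> p (s + T') (\<lambda>t. if t \<in> {0..s} then u t else u' (t - s))
    (\<lambda>t. if t \<in> {0..s} then x t else x' (t - s)) (\<lambda>t. if t \<in> {0..s} then y t else y' (t - s))"
    unfolding steers_to_origin_def
  proof (intro conjI concat)
    \<comment> \<open>If \<open>T' = 0\<close>, the final instant still belongs to the first piece,
      whose end point is then the start and end of the second.\<close>
    show "cyl_eq (if s + T' \<in> {0..s} then x (s + T') else x' (s + T' - s),
        if s + T' \<in> {0..s} then y (s + T') else y' (s + T' - s)) (0, 0)"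
      using c(2-4) T' assms(3) by (cases "T' = 0") auto
  qed (use assms(1,3) c(2,3) cyl in auto)
  then show ?thesis
    using assms(2) unfolding optimal_trajectory_def by blast
qed

lemma zero_count_bounded:
  assumes "\<epsilon> > 0"
  obtains K where "\<And>p T u x y \<phi> \<psi>. optimal_trajectory \<epsilon> p T u x y \<Longrightarrow>
    adjoint_variables \<epsilon> T u x y \<phi> \<psi> \<Longrightarrow> zero_count T \<psi> \<le> enat K"
proof -
  obtain M where M: "\<And>a. \<exists>T u x y. T \<le> M \<and> trajectory \<epsilon> T u x y \<and> x 0 = a \<and> y 0 = 0 \<and>
      cyl_eq (x T, y T) (0, 0)"
    using steer_to_origin_bounded[OF assms] by blast
  \<comment> \<open>One for the first zero, and \<open>nat \<lfloor>M\<rfloor> + 1\<close> for the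
    separated zeros within time \<open>M\<close> after the rest instant.\<close>
  have "zero_count T \<psi> \<le> enat (nat \<lfloor>M\<rfloor> + 2)"
    if opt: "optimal_trajectory \<epsilon> p T u x y" and adj: "adjoint_variables \<epsilon> T u x y \<phi> \<psi>"
    for p T u x y \<phi> \<psi>
  proof -
    have tr: "trajectory \<epsilon> T u x y"
      using opt unfolding optimal_trajectory_def steers_to_origin_def by blast
    define Z where "Z = {t \<in> {0..T}. \<psi> t = 0}"
    have sep: "1 \<le> t - s" if "s \<in> Z" "t \<in> Z" "s < t" for s t
    proof (rule zeros_separated)
      show "(\<phi> has_real_derivative cos (x r) * \<psi> r) (at r within {s..t})"
        "(\<psi> has_real_derivative - \<phi> r) (at r within {s..t})" if "r \<in> {s..t}" for r
        using adjoint_derivatives[OF adj _ _ that] \<open>s \<in> Z\<close> \<open>t \<in> Z\<close> by (simp_all add: Z_def)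
      show "\<phi> s \<noteq> 0"
        using adjoint_at_zero[OF assms _ tr adj, of s] that by (auto simp: Z_def)
    qed (use that in \<open>auto simp: Z_def\<close>)
    have "finite Z"
      using sep by (intro card_separated_le(1)[of Z 0 T]) (auto simp: Z_def)
    have "card Z \<le> nat \<lfloor>M\<rfloor> + 2"
    proof (cases "card Z \<le> 1")
      case False
      define s where "s = Min Z"
      define t where "t = Min (Z - {s})"
      have "Z \<noteq> {}"
        using False by auto
      then have s: "s \<in> Z" "\<And>r. r \<in> Z \<Longrightarrow> s \<le> r"
        using \<open>finite Z\<close> by (auto simp: s_def)
      then have cZ: "card Z = card (Z - {s}) + 1"
        using \<open>finite Z\<close> False by simp
      then have "Z - {s} \<noteq> {}"
        using False by force
      then have "t \<in> Z - {s}" and t: "\<And>r. r \<in> Z \<Longrightarrow> r \<noteq> s \<Longrightarrow> t \<le> r"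
        using \<open>finite Z\<close> Min_in[of "Z - {s}"] by (auto simp: t_def)
      then have "s < t" "t \<in> Z"
        using s(2)[of t] by auto
      have "\<psi> r \<noteq> 0" if "s < r" "r < t" for r
        using t[of r] that s(1) \<open>t \<in> Z\<close> by (auto simp: Z_def)
      then obtain r where r: "s \<le> r" "r \<le> t" "y r = 0"
        using velocity_zero_between[OF assms tr adj, of s t] \<open>s < t\<close> \<open>t \<in> Z\<close> s(1)
        by (auto simp: Z_def)
      have "r \<in> {0..T}"
        using r s(1) \<open>t \<in> Z\<close> by (auto simp: Z_def)
      obtain T' u' x' y' where "T' \<le> M" "trajectory \<epsilon> T' u' x' y'" "x' 0 = x r" "y' 0 = 0"
        "cyl_eq (x' T', y' T') (0, 0)"
        using M[of "x r"] by blast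
      then have "T \<le> r + M"
        using optimal_time_from_rest[OF assms opt \<open>r \<in> {0..T}\<close>, of T' u' x' y'] r(3) by simp
      \<comment> \<open>The rest instant \<open>r\<close> is at most the second zero
        \<open>t\<close>, so only the first zero \<open>s\<close> can precede it.\<close>
      then have "Z - {s} \<subseteq> {r..r + M}"
        using t r by (force simp: Z_def)
      then have "card (Z - {s}) \<le> nat \<lfloor>r + M - r\<rfloor> + 1"
        using sep by (intro card_separated_le(2)) auto
      with cZ show ?thesis
        by simp
    qed auto
    then show ?thesis
      using \<open>finite Z\<close> unfolding zero_count_def Z_def[symmetric] by simp
  qed
  then show ?thesis
    by (rule that)
qed

theorem theorem1p1:
  fixes \<epsilon> :: real
  assumes "\<epsilon> > 0"
  shows "N_sup \<epsilon> < \<infinity>"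
proof -
  obtain K where K: "\<And>p T u x y \<phi> \<psi>. optimal_trajectory \<epsilon> p T u x y \<Longrightarrow>
      adjoint_variables \<epsilon> T u x y \<phi> \<psi> \<Longrightarrow> zero_count T \<psi> \<le> enat K"
    using zero_count_bounded[OF assms] by blast
  have "N_sup \<epsilon> \<le> enat K"
    unfolding N_sup_def N_at_def by (intro SUP_least Sup_least) (auto intro: K)
  then show ?thesis
    by (rule le_less_trans) simp
qed

end
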